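(* For $n\geq 1$ let $$\widehat K_n(x_1,\dots,x_n)=\sum_{\pi\in\mathfrak S_n}\ \prod_{j\in\operatorname{PKV}(\pi)}x_j .$$ The polynomial $\widehat K_n(x_1,\dots,x_n)$ is stable for every $n\geq 1$. Moreover, for every sequence $\lambda_1,\lambda_2,\dots$ of positive real numbers and every integer $n>1$, $$\widehat K_{n-1}(\lambda_1t,\dots,\lambda_{n-1}t)\preceq\widehat K_n(\lambda_1t,\dots,\lambda_nt)$$ as polynomials in $t$.
   Context: $\mathfrak S_n$ is the symmetric group on $\{1,\dots,n\}$, with permutations in one-line notation $\pi=\pi_1\cdots\pi_n$. A peak of $\pi$ is an index $2\leq i\leq n-1$ with $\pi_{i-1}<\pi_i>\pi_{i+1}$, and $\operatorname{PKV}(\pi)$ is the set of values $\pi_i$ at the peaks $i$ of $\pi$. A polynomial in several complex variables is stable if it does not vanish when all variables lie in the open upper half-plane. A univariate polynomial is real-rooted if all its complex zeros are real (nonzero constants are real-rooted). For nonzero real-rooted polynomials $g,f$ with positive leading coefficients, $g\preceq f$ means that $\deg f-\deg g\in\{0,1\}$ and the roots alternate as follows: if $g$ is constant there is no further condition; otherwise, with $d=\deg g\geq 1$, roots $u_1\geq\cdots\geq u_d$ of $g$ and roots $v_1\geq v_2\geq\cdots$ of $f$ listed with multiplicity, $v_1\geq u_1\geq v_2\geq\cdots\geq u_d\geq v_{d+1}$ if $\deg f=d+1$, and $v_1\geq u_1\geq v_2\geq\cdots\geq v_d\geq u_d$ if $\deg f=d$. (The assertion $g\preceq f$ includes that $g$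 and $f$ are real-rooted.) *)

theory Defs
  imports
    "HOL-Analysis.Analysis"
    "HOL-Combinatorics.Permutations"
    "HOL-Computational_Algebra.Computational_Algebra"
begin

definition peak_set :: "nat \<Rightarrow> (nat \<Rightarrow> nat) \<Rightarrow> nat set" where
  "peak_set n \<pi> = {i. 2 \<le> i \<and> i < n \<and> \<pi> (i - 1) < \<pi> i \<and> \<pi> i > \<pi> (i + 1)}"

definition PKV :: "nat \<Rightarrow> (nat \<Rightarrow> nat) \<Rightarrow> nat set" where
  "PKV n \<pi> = \<pi> ` peak_set n \<pi>"

text \<open>
  The variables \<open>x 1, \<dots>, x n\<close> range over an arbitrary commutative ring, so that the same
  expression can be evaluated at complex numbers and at univariate polynomials.
  Values of \<open>x\<close> outside \<open>{1..n}\<close> are irrelevant.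
\<close>

definition Khat :: "nat \<Rightarrow> (nat \<Rightarrow> 'a) \<Rightarrow> 'a::comm_ring_1" where
  "Khat n x = (\<Sum>\<pi> | \<pi> permutes {1..n}. \<Prod>j\<in>PKV n \<pi>. x j)"

text \<open>A polynomial in \<open>n\<close> complex variables is represented by its polynomial function.\<close>

definition stable_poly :: "nat \<Rightarrow> ((nat \<Rightarrow> complex) \<Rightarrow> complex) \<Rightarrow> bool" where
  "stable_poly n F \<longleftrightarrow> (\<forall>z. (\<forall>j\<in>{1..n}. Im (z j) > 0) \<longrightarrow> F z \<noteq> 0)"

definition real_rooted :: "real poly \<Rightarrow> bool" where
  "real_rooted p \<longleftrightarrow> (\<forall>z::complex. poly (map_poly of_real p) z = 0 \<longrightarrow> z \<in> \<real>)"

text \<open>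
  The real roots of a nonzero polynomial with multiplicity, in weakly decreasing order; the list
  has length \<open>degree p\<close> if \<open>p\<close> is real-rooted. List positions start at \<open>0\<close>, so \<open>roots_desc p ! i\<close>
  is the \<open>(i+1)\<close>-st largest root.
\<close>

definition roots_desc :: "real poly \<Rightarrow> real list" where
  "roots_desc p = rev (sorted_list_of_multiset (proots p))"

definition interlaces :: "real poly \<Rightarrow> real poly \<Rightarrow> bool" (infix "\<preceq>" 50) where
  "g \<preceq> f \<longleftrightarrow>
     g \<noteq> 0 \<and> f \<noteq> 0 \<and> real_rooted g \<and> real_rooted f \<and> lead_coeff g > 0 \<and> lead_coeff f > 0 \<and>
     (let d = degree g; u = roots_desc g; v = roots_desc f in
       (degree f = d \<or> degree f = d + 1) \<and>
       (d \<ge> 1 \<longrightarrow>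
         (degree f = d + 1 \<longrightarrow> (\<forall>i<d. v ! i \<ge> u ! i \<and> u ! i \<ge> v ! (i + 1))) \<and>
         (degree f = d \<longrightarrow> (\<forall>i<d. v ! i \<ge> u ! i) \<and> (\<forall>i. i + 1 < d \<longrightarrow> u ! i \<ge> v ! (i + 1)))))"

end

theory Submission
  imports Defs
begin

text \<open>
  Inserting the value \<open>n + 1\<close> into a permutation of \<open>{1..n}\<close> gives, for \<open>K\<^sub>n = Khat n\<close>,
  \<open>K\<^sub>n\<^sub>+\<^sub>1 = 2 K\<^sub>n + x\<^sub>n\<^sub>+\<^sub>1 ((n - 1) K\<^sub>n - 2 \<Sum>\<^sub>j (x\<^sub>j - 1) \<partial>\<^sub>j K\<^sub>n)\<close>, that is
  \<open>K\<^sub>n\<^sub>+\<^sub>1 = 2 K\<^sub>n (1 + x\<^sub>n\<^sub>+\<^sub>1 v)\<close> with \<open>v = (n - 1) / 2 - p'(1) / p(1)\<close> and \<open>p(s) = K\<^sub>n(1 + s (x - 1))\<close>,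
  a polynomial of degree at most \<open>(n - 1) / 2\<close>. By induction, \<open>K\<^sub>n\<close> has no zero whose coordinates all
  lie in an open half-plane \<open>Re (a x) > 0\<close> with \<open>Re a > 0\<close>: the induction hypothesis confines the zeros
  of \<open>p\<close> so that \<open>Re (v / a) \<ge> 0\<close>, whereas \<open>v = - 1 / x\<^sub>n\<^sub>+\<^sub>1\<close> would give \<open>Re (v / a) < 0\<close>. Letting \<open>a\<close>
  tend to \<open>- i\<close> gives stability.

  On the ray \<open>x\<^sub>j = \<lambda>\<^sub>j t\<close> with \<open>Im t > 0\<close>, letting \<open>1 / a\<close> tend to \<open>- i t\<close> gives \<open>Im (t v) \<ge> 0\<close>, so the quotient
  of consecutive polynomials maps the upper half-plane into its closure. For real-rooted \<open>f\<close> and \<open>g\<close>,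
  \<open>Im (f / g) \<ge> 0\<close> there forces interlacing: along \<open>c + i s\<close>, \<open>s > 0\<close>, the argument of \<open>f / g\<close> moves from \<open>\<pi>\<close> times
  the difference of the numbers of roots above \<open>c\<close> to \<open>\<pi> / 2\<close> times the difference of the degrees, without
  leaving an interval on which \<open>sin\<close> is nonnegative.
\<close>

section \<open>Insertion of the maximum\<close>

text \<open>
  Composing \<open>\<sigma> \<in> S\<^sub>n\<close> with this cycle inserts the value \<open>n + 1\<close> at position \<open>k\<close> of the word of \<open>\<sigma>\<close>.
\<close>

definition insert_max_cycle :: "nat \<Rightarrow> nat \<Rightarrow> nat \<Rightarrow> nat" where
  "insert_max_cycle n k i =
     (if i < k \<or> Suc n < i then i else if i = k then Suc n else i - 1)"

lemma insert_max_cycle_permutes: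
  assumes "k \<in> {1..Suc n}"
  shows "insert_max_cycle n k permutes {1..Suc n}"
proof -
  have "bij (insert_max_cycle n k)"
  proof (rule bijI)
    show "inj (insert_max_cycle n k)"
      using assms by (auto simp: inj_def insert_max_cycle_def split: if_splits)
    show "surj (insert_max_cycle n k)"
    \<comment> \<open>The witness is the inverse of the cycle.\<close>
    proof (rule surjI[where f = "\<lambda>i. if i < k \<or> Suc n < i then i else if i = Suc n then k else Suc i"])
      show "insert_max_cycle n k (if i < k \<or> Suc n < i then i else if i = Suc n then k else Suc i) = i" for i
        using assms by (auto simp: insert_max_cycle_def)
    qed
  qed
  moreover have "\<forall>i. i \<notin> {1..Suc n} \<longrightarrow> insert_max_cycle n k i = i"
    using assms by (auto simp: insert_max_cycle_def)
  ultimately show ?thesis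
    unfolding permutes_def bij_iff by blast
qed

text \<open>The pair is recovered from the composition: \<open>k\<close> is the position of the
  value \<open>Suc n\<close>. Surjectivity then follows by counting, as (n + 1) n! = (n +
  1)!.\<close>

lemma insert_max_bij:
  "bij_betw (\<lambda>(\<sigma>, k). \<sigma> \<circ> insert_max_cycle n k)
     ({\<sigma>. \<sigma> permutes {1..n}} \<times> {1..Suc n}) {\<pi>. \<pi> permutes {1..Suc n}}"
proof -
  let ?F = "\<lambda>(\<sigma>, k). \<sigma> \<circ> insert_max_cycle n k"
  let ?A = "{\<sigma>. \<sigma> permutes {1..n}} \<times> {1..Suc n}"
  have inj: "inj_on ?F ?A"
  proof (rule inj_onI, clarify)
    fix \<sigma> k \<tau> m
    assume \<sigma>: "\<sigma> permutes {1..n}" and \<tau>: "\<tau> permutes {1..n}"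
      and k: "k \<in> {1..Suc n}" and m: "m \<in> {1..Suc n}"
      and eq: "\<sigma> \<circ> insert_max_cycle n k = \<tau> \<circ> insert_max_cycle n m"
    have ck: "insert_max_cycle n k k = Suc n" and cm: "insert_max_cycle n m m = Suc n"
      using k m by (auto simp: insert_max_cycle_def)
    have fix_max: "\<sigma> (Suc n) = Suc n" "\<tau> (Suc n) = Suc n"
      using \<sigma> \<tau> by (auto simp: permutes_def)
    have "inj (\<tau> \<circ> insert_max_cycle n m)"
      using \<tau> insert_max_cycle_permutes[OF m] by (simp add: inj_compose permutes_inj)
    moreover have "(\<tau> \<circ> insert_max_cycle n m) k = (\<tau> \<circ> insert_max_cycle n m) m"
      using fun_cong[OF eq, of k] ck cm fix_max by simp
    ultimately have "k = m" by (rule injD)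
    moreover from this have "\<sigma> = \<tau>"
      using eq permutes_surj[OF insert_max_cycle_permutes[OF m]]
      by (metis surj_fun_eq)
    ultimately show "\<sigma> = \<tau> \<and> k = m" by simp
  qed
  have "?F ` ?A \<subseteq> {\<pi>. \<pi> permutes {1..Suc n}}"
  proof clarify
    fix \<sigma> k assume "\<sigma> permutes {1..n}" and k: "k \<in> {1..Suc n}"
    then have "\<sigma> permutes {1..Suc n}"
      by (auto intro: permutes_subset)
    with insert_max_cycle_permutes[OF k]
    show "\<sigma> \<circ> insert_max_cycle n k permutes {1..Suc n}"
      by (rule permutes_compose)
  qed
  moreover have "card ?A = card {\<pi>. \<pi> permutes {1..Suc n}}"
    using card_permutations[of "{1..n}" n] card_permutations[of "{1..Suc n}" "Suc n"]
    by (simp only: card_cartesian_product) simp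
  ultimately show ?thesis
    using inj unfolding bij_betw_def
    by (metis card_image card_subset_eq finite_permutations finite_atLeastAtMost)
qed

section \<open>Peaks and their behaviour under insertion\<close>

lemma finite_peak_set [simp]: "finite (peak_set n \<pi>)"
  by (rule finite_subset[of _ "{..n}"]) (auto simp: peak_set_def)

lemma peak_set_not_adjacent: "i \<in> peak_set n \<pi> \<Longrightarrow> Suc i \<notin> peak_set n \<pi>"
  by (auto simp: peak_set_def)

text \<open>Peaks are never adjacent, so the peak set and its shift by one are disjoint subsets of
  \<open>{2..n}\<close>.\<close>

lemma card_peak_set: "2 * card (peak_set n \<pi>) \<le> n - 1"
proof -
  have "card (peak_set n \<pi> \<union> Suc ` peak_set n \<pi>) = card (peak_set n \<pi>) + card (Suc ` peak_set n \<pi>)"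
    by (rule card_Un_disjoint) (auto dest: peak_set_not_adjacent)
  moreover have "card (Suc ` peak_set n \<pi>) = card (peak_set n \<pi>)"
    by (simp add: card_image)
  moreover have "card (peak_set n \<pi> \<union> Suc ` peak_set n \<pi>) \<le> card {2..n}"
    by (rule card_mono) (auto simp: peak_set_def)
  ultimately show ?thesis by simp
qed

lemma prod_PKV:
  assumes "\<pi> permutes S"
  shows "(\<Prod>j\<in>PKV n \<pi>. f j) = (\<Prod>i\<in>peak_set n \<pi>. f (\<pi> i))"
  unfolding PKV_def
  using prod.reindex[OF permutes_inj_on[OF assms]] by (simp add: o_def)

lemma Khat_peak_set: "Khat n x = (\<Sum>\<pi> | \<pi> permutes {1..n}. \<Prod>i\<in>peak_set n \<pi>. x (\<pi> i))"
  unfolding Khat_def by (intro sum.cong) (auto intro: prod_PKV)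

text \<open>A maximum at either end is no peak. The entry next to it was an end of the old word and
  is now beside the maximum, hence no peak before or after. The peaks keep their values; for
  \<open>k = 1\<close> their positions shift by one.\<close>

lemma prod_peak_set_insert_max_ends:
  assumes \<sigma>: "\<sigma> permutes {1..n}" and k: "k = 1 \<or> k = Suc n" and n: "n \<ge> 1"
  shows "(\<Prod>i\<in>peak_set (Suc n) (\<sigma> \<circ> insert_max_cycle n k). x ((\<sigma> \<circ> insert_max_cycle n k) i)) =
    (\<Prod>i\<in>peak_set n \<sigma>. x (\<sigma> i))"
proof (cases "k = 1")
  case True
  have le: "\<sigma> i \<le> n" if "i \<in> {1..n}" for i
    using permutes_in_image[OF \<sigma>] that by auto
  have fm: "\<sigma> (Suc n) = Suc n" using \<sigma> by (auto simp: permutes_def)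
  have "peak_set (Suc n) (\<sigma> \<circ> insert_max_cycle n k) = Suc ` peak_set n \<sigma>"
  proof (rule set_eqI)
    fix i
    show "i \<in> peak_set (Suc n) (\<sigma> \<circ> insert_max_cycle n k) \<longleftrightarrow> i \<in> Suc ` peak_set n \<sigma>"
    proof (cases i)
      case (Suc m)
      show ?thesis
      proof (cases "m = 1")
        case True
        then show ?thesis using Suc le[of 1] n fm \<open>k = 1\<close>
          by (auto simp: peak_set_def insert_max_cycle_def)
      next
        case False
        then show ?thesis using Suc \<open>k = 1\<close>
          by (auto simp: peak_set_def insert_max_cycle_def)
      qed
    qed (auto simp: peak_set_def)
  qed
  then show ?thesis using True
    by (auto simp: prod.reindex insert_max_cycle_def peak_set_def intro!: prod.cong)
next
  case False
  then have k: "k = Suc n" using k by simp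
  have le: "\<sigma> i \<le> n" if "i \<in> {1..n}" for i
    using permutes_in_image[OF \<sigma>] that by auto
  have fm: "\<sigma> (Suc n) = Suc n" using \<sigma> by (auto simp: permutes_def)
  have "peak_set (Suc n) (\<sigma> \<circ> insert_max_cycle n k) = peak_set n \<sigma>"
  proof (rule set_eqI)
    fix i
    show "i \<in> peak_set (Suc n) (\<sigma> \<circ> insert_max_cycle n k) \<longleftrightarrow> i \<in> peak_set n \<sigma>"
    proof (cases "i = n")
      case True
      then show ?thesis using le[of n] n fm k
        by (auto simp: peak_set_def insert_max_cycle_def)
    next
      case False
      then show ?thesis using k
        by (auto simp: peak_set_def insert_max_cycle_def)
    qed
  qed
  then show ?thesis using k
    by (auto simp: insert_max_cycle_def peak_set_def intro!: prod.cong)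
qed

text \<open>The inserted maximum has two smaller neighbours, so it is a peak. These neighbours, at
  the old positions \<open>k - 1\<close> and \<open>k\<close>, can no longer be peaks; all other
  local comparisons are unchanged.\<close>

lemma prod_peak_set_insert_max_interior:
  assumes \<sigma>: "\<sigma> permutes {1..n}" and k: "k \<in> {2..n}"
  shows "(\<Prod>i\<in>peak_set (Suc n) (\<sigma> \<circ> insert_max_cycle n k). x ((\<sigma> \<circ> insert_max_cycle n k) i)) =
    x (Suc n) * (\<Prod>i\<in>peak_set n \<sigma> - {k - 1, k}. x (\<sigma> i))"
proof -
  let ?\<pi> = "\<sigma> \<circ> insert_max_cycle n k"
  \<comment> \<open>\<open>?r\<close> sends a position of the old word to its position in the new
    one, skipping \<open>k\<close>.\<close>
  let ?r = "\<lambda>i. if i < k then i else Suc i"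
  have le: "\<sigma> i \<le> n" if "i \<in> {1..n}" for i
    using permutes_in_image[OF \<sigma>] that by auto
  have fm: "\<sigma> (Suc n) = Suc n" using \<sigma> by (auto simp: permutes_def)
  have at_r: "?\<pi> (?r i) = \<sigma> i" if "i \<le> n" for i
    using that k by (auto simp: insert_max_cycle_def)
  have at_k: "?\<pi> k = Suc n"
    using fm k by (auto simp: insert_max_cycle_def)
  have small: "?\<pi> i \<le> n" if "i \<in> {1..Suc n}" "i \<noteq> k" for i
  proof (cases "i < k")
    case True
    then show ?thesis using that le[of i] k by (auto simp: insert_max_cycle_def)
  next
    case False
    then have "i - 1 \<in> {1..n}" using that k by auto
    then show ?thesis using that False le[of "i - 1"] by (auto simp: insert_max_cycle_def)
  qed
  have "peak_set (Suc n) ?\<pi> = insert k (?r ` (peak_set n \<sigma> - {k - 1, k}))"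
  proof (rule set_eqI)
    fix i
    consider "i < k - 1" | "i = k - 1" | "i = k" | "i = k + 1" | "i > k + 1" by linarith
    then show "i \<in> peak_set (Suc n) ?\<pi> \<longleftrightarrow> i \<in> insert k (?r ` (peak_set n \<sigma> - {k - 1, k}))"
    proof cases
      case 1
      then have "?\<pi> (i - 1) = \<sigma> (i - 1)" "?\<pi> i = \<sigma> i" "?\<pi> (i + 1) = \<sigma> (i + 1)" "i < n"
        using k by (auto simp: insert_max_cycle_def)
      then have "i \<in> peak_set (Suc n) ?\<pi> \<longleftrightarrow> i \<in> peak_set n \<sigma>"
        unfolding peak_set_def mem_Collect_eq by (simp only:) simp
      moreover have "i \<in> ?r ` A \<longleftrightarrow> i \<in> A" for A using 1 by (auto simp: image_iff)
      moreover have "i \<noteq> k" "i \<noteq> k - 1" using 1 by auto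
      ultimately show ?thesis by (simp only: insert_iff Diff_iff empty_iff) blast
    next
      case 2
      then have i: "Suc i = k" "i \<noteq> k" "i \<in> {1..Suc n}" using k by auto
      have "?\<pi> i < ?\<pi> (i + 1)" using small[OF i(3,2)] at_k i(1) by (simp del: o_apply)
      then have "i \<notin> peak_set (Suc n) ?\<pi>"
        unfolding peak_set_def by simp
      moreover have "i \<notin> insert k (?r ` (peak_set n \<sigma> - {k - 1, k}))"
        using 2 k by auto
      ultimately show ?thesis by (simp only:)
    next
      case 3
      have "k - 1 \<in> {1..Suc n}" "k - 1 \<noteq> k" "k + 1 \<in> {1..Suc n}" "k + 1 \<noteq> k" using k by auto
      then have "?\<pi> (k - 1) < ?\<pi> k" "?\<pi> (k + 1) < ?\<pi> k"
        using small[of "k - 1"] small[of "k + 1"] unfolding at_k less_Suc_eq_le by blast+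
      then have "i \<in> peak_set (Suc n) ?\<pi>" unfolding peak_set_def using 3 k by simp
      then show ?thesis using 3 by simp
    next
      case 4
      then have i: "i - 1 = k" "i \<noteq> k" "i \<in> {1..Suc n}" using k by auto
      have "?\<pi> i < ?\<pi> (i - 1)" using small[OF i(3,2)] at_k i(1) by (simp del: o_apply)
      then have "i \<notin> peak_set (Suc n) ?\<pi>"
        unfolding peak_set_def by simp
      moreover have "i \<notin> insert k (?r ` (peak_set n \<sigma> - {k - 1, k}))"
        using 4 k by auto
      ultimately show ?thesis by (simp only:)
    next
      case 5
      then obtain m where m: "i = Suc m" "m > k" by (cases i) auto
      have "i \<in> peak_set (Suc n) ?\<pi> \<longleftrightarrow> m \<in> peak_set n \<sigma>"
      proof (cases "m < n")
        case True
        then have "?\<pi> (i - 1) = \<sigma> (m - 1)" "?\<pi> i = \<sigma> m" "?\<pi> (i + 1) = \<sigma> (m + 1)"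
          using k m by (simp_all add: insert_max_cycle_def)
        moreover have "2 \<le> i \<and> i < Suc n" "2 \<le> m \<and> m < n" using True m k by auto
        ultimately show ?thesis
          unfolding peak_set_def mem_Collect_eq by (simp only:)
      next
        case False
        then show ?thesis using m by (simp add: peak_set_def)
      qed
      moreover have "i \<in> ?r ` A \<longleftrightarrow> m \<in> A" for A using m by (auto simp: image_iff split: if_splits)
      moreover have "i \<noteq> k" "m \<noteq> k" "m \<noteq> k - 1" using m by auto
      ultimately show ?thesis by (simp only: insert_iff Diff_iff empty_iff) blast
    qed
  qed
  then have "(\<Prod>i\<in>peak_set (Suc n) ?\<pi>. x (?\<pi> i)) =
      (\<Prod>i\<in>insert k (?r ` (peak_set n \<sigma> - {k - 1, k})). x (?\<pi> i))"
    by (simp only:)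
  also have "\<dots> = x (?\<pi> k) * (\<Prod>i\<in>?r ` (peak_set n \<sigma> - {k - 1, k}). x (?\<pi> i))"
    by (rule prod.insert) auto
  also have "(\<Prod>i\<in>?r ` (peak_set n \<sigma> - {k - 1, k}). x (?\<pi> i)) =
      (\<Prod>i\<in>peak_set n \<sigma> - {k - 1, k}. x (?\<pi> (?r i)))"
    by (subst prod.reindex) (auto simp: inj_on_def comp_def split: if_splits)
  also have "(\<Prod>i\<in>peak_set n \<sigma> - {k - 1, k}. x (?\<pi> (?r i))) = (\<Prod>i\<in>peak_set n \<sigma> - {k - 1, k}. x (\<sigma> i))"
    by (intro prod.cong refl) (subst at_r, auto simp: peak_set_def)
  finally show ?thesis unfolding at_k .
qed

text \<open>Deleting the factor at \<open>p\<close> subtracts \<open>d p\<close> from the product.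
  As \<open>P\<close> has no adjacent elements, each \<open>k\<close> deletes at most one factor;
  each \<open>p\<close> is deleted exactly twice, for \<open>k = p\<close> and
  \<open>k = p + 1\<close>, both in \<open>{2..n}\<close>.\<close>

lemma sum_remove_adjacent:
  fixes y :: "nat \<Rightarrow> 'a::comm_ring_1"
  assumes P: "P \<subseteq> {2..<n}" and adj: "\<And>i. i \<in> P \<Longrightarrow> Suc i \<notin> P" and n: "n \<ge> 1"
  shows "(\<Sum>k=2..n. \<Prod>i\<in>P - {k - 1, k}. y i) =
    of_nat (n - 1) * (\<Prod>i\<in>P. y i) - 2 * (\<Sum>p\<in>P. (y p - 1) * (\<Prod>i\<in>P - {p}. y i))"
proof -
  define d where "d p = (y p - 1) * (\<Prod>i\<in>P - {p}. y i)" for p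
  have fin: "finite P" using P finite_subset by blast
  have d: "(\<Prod>i\<in>P - {p}. y i) = (\<Prod>i\<in>P. y i) - d p" if "p \<in> P" for p
    using prod.remove[OF fin that, of y] by (simp add: d_def algebra_simps)
  have step: "(\<Prod>i\<in>P - {k - 1, k}. y i) =
      (\<Prod>i\<in>P. y i) - (if k \<in> P then d k else 0) - (if k - 1 \<in> P then d (k - 1) else 0)"
    if "k \<in> {2..n}" for k
  proof -
    have "\<not> (k \<in> P \<and> k - 1 \<in> P)" using adj[of "k - 1"] that by auto
    then consider "k \<in> P" "k - 1 \<notin> P" | "k - 1 \<in> P" "k \<notin> P" | "k \<notin> P" "k - 1 \<notin> P" by blast
    then show ?thesis
    proof cases
      case 1
      then have "P - {k - 1, k} = P - {k}" by auto
      then show ?thesis using 1 d[of k] by simp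
    next
      case 2
      then have "P - {k - 1, k} = P - {k - 1}" by auto
      then show ?thesis using 2 d[of "k - 1"] by simp
    next
      case 3
      then have "P - {k - 1, k} = P" by auto
      then show ?thesis using 3 by simp
    qed
  qed
  have "(\<Sum>k=2..n. \<Prod>i\<in>P - {k - 1, k}. y i) = (\<Sum>k=2..n. (\<Prod>i\<in>P. y i) -
      (if k \<in> P then d k else 0) - (if k - 1 \<in> P then d (k - 1) else 0))"
    by (intro sum.cong refl step)
  moreover have "(\<Sum>k=2..n. if k \<in> P then d k else 0) = sum d P"
    using P by (subst sum.inter_restrict[symmetric]) (auto intro!: sum.cong)
  moreover have "(\<Sum>k=2..n. if k - 1 \<in> P then d (k - 1) else 0) = sum d P"
  proof -
    have "(\<Sum>k=2..n. if k - 1 \<in> P then d (k - 1) else 0) = (\<Sum>k | k \<in> {2..n} \<and> k - 1 \<in> P. d (k - 1))"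
      by (subst sum.inter_filter) auto
    also have "\<dots> = sum d P"
      by (rule sum.reindex_bij_witness[of _ Suc "\<lambda>k. k - 1"]) (use P in auto)
    finally show ?thesis .
  qed
  moreover have "(\<Sum>k=2..n. \<Prod>i\<in>P. y i) = of_nat (n - 1) * (\<Prod>i\<in>P. y i)"
    using n by simp
  ultimately show ?thesis
    unfolding d_def[symmetric] by (simp only: sum_subtractf) simp
qed

text \<open>For fixed \<open>\<sigma>\<close> the two end positions contribute twice its weight, and
  the interior ones are summed by \<open>sum_remove_adjacent\<close>. The double sum is the operator
  with terms \<open>x j - 1\<close> times the partial derivative in \<open>x j\<close>, since every
  weight is squarefree.\<close>

lemma Khat_Suc:
  fixes x :: "nat \<Rightarrow> 'a::comm_ring_1"
  assumes n: "n \<ge> 1"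
  shows "Khat (Suc n) x = 2 * Khat n x + x (Suc n) * (of_nat (n - 1) * Khat n x -
    2 * (\<Sum>\<pi> | \<pi> permutes {1..n}. \<Sum>p\<in>peak_set n \<pi>. (x (\<pi> p) - 1) * (\<Prod>i\<in>peak_set n \<pi> - {p}. x (\<pi> i))))"
proof -
  let ?w = "\<lambda>n \<pi>. \<Prod>i\<in>peak_set n \<pi>. x (\<pi> i)"
  let ?D = "\<lambda>\<pi>. \<Sum>p\<in>peak_set n \<pi>. (x (\<pi> p) - 1) * (\<Prod>i\<in>peak_set n \<pi> - {p}. x (\<pi> i))"
  have step: "(\<Sum>k=1..Suc n. ?w (Suc n) (\<sigma> \<circ> insert_max_cycle n k)) =
      2 * ?w n \<sigma> + x (Suc n) * (of_nat (n - 1) * ?w n \<sigma> - 2 * ?D \<sigma>)"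
    if \<sigma>: "\<sigma> permutes {1..n}" for \<sigma>
  proof -
    have "{1..Suc n} = insert 1 (insert (Suc n) {2..n})" using n by auto
    then have "(\<Sum>k=1..Suc n. ?w (Suc n) (\<sigma> \<circ> insert_max_cycle n k)) =
        2 * ?w n \<sigma> + (\<Sum>k=2..n. ?w (Suc n) (\<sigma> \<circ> insert_max_cycle n k))"
      using n prod_peak_set_insert_max_ends[OF \<sigma> _ n, of 1 x]
        prod_peak_set_insert_max_ends[OF \<sigma> _ n, of "Suc n" x] by simp
    also have "(\<Sum>k=2..n. ?w (Suc n) (\<sigma> \<circ> insert_max_cycle n k)) =
        x (Suc n) * (\<Sum>k=2..n. \<Prod>i\<in>peak_set n \<sigma> - {k - 1, k}. x (\<sigma> i))"
      unfolding sum_distrib_left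
      by (intro sum.cong refl prod_peak_set_insert_max_interior[OF \<sigma>])
    also have "(\<Sum>k=2..n. \<Prod>i\<in>peak_set n \<sigma> - {k - 1, k}. x (\<sigma> i)) =
        of_nat (n - 1) * ?w n \<sigma> - 2 * ?D \<sigma>"
      by (rule sum_remove_adjacent) (use n in \<open>auto simp: peak_set_def\<close>)
    finally show ?thesis .
  qed
  have "Khat (Suc n) x =
      (\<Sum>(\<sigma>, k)\<in>{\<sigma>. \<sigma> permutes {1..n}} \<times> {1..Suc n}. ?w (Suc n) (\<sigma> \<circ> insert_max_cycle n k))"
    unfolding Khat_peak_set
    by (subst sum.reindex_bij_betw[OF insert_max_bij, symmetric]) (simp add: case_prod_unfold)
  also have "\<dots> = (\<Sum>\<sigma> | \<sigma> permutes {1..n}. \<Sum>k=1..Suc n. ?w (Suc n) (\<sigma> \<circ> insert_max_cycle n k))"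
    by (rule sum.cartesian_product[symmetric])
  also have "\<dots> = (\<Sum>\<sigma> | \<sigma> permutes {1..n}. 2 * ?w n \<sigma> + x (Suc n) * (of_nat (n - 1) * ?w n \<sigma> - 2 * ?D \<sigma>))"
    by (intro sum.cong refl step) simp
  finally show ?thesis
    unfolding Khat_peak_set
    by (simp only: sum.distrib sum_subtractf sum_distrib_left[symmetric])
qed

section \<open>Zero-free half-planes\<close>

lemma Khat_1: "Khat (Suc 0) x = 1"
proof -
  have "{\<pi>. \<pi> permutes {1..Suc 0}} = {id}" by (auto simp: permutes_sing)
  moreover have "peak_set (Suc 0) id = {}" by (auto simp: peak_set_def)
  ultimately show ?thesis by (simp add: Khat_peak_set)
qed

lemma poly_Khat: "poly (Khat n x) c = Khat n (\<lambda>j. poly (x j) c)"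
  by (simp add: Khat_def poly_sum poly_prod)

lemma map_poly_of_real_add:
  "map_poly of_real (p + q) = map_poly of_real p + map_poly of_real q"
  by (simp add: poly_eq_iff coeff_map_poly)

lemma map_poly_of_real_mult:
  "map_poly (of_real :: real \<Rightarrow> 'a::{real_algebra_1,comm_ring_1}) (p * q) =
    map_poly of_real p * map_poly of_real q"
proof (induction p)
  case (pCons a p)
  have "map_poly of_real (smult a q) = smult (of_real a :: 'a) (map_poly of_real q)"
    by (simp add: poly_eq_iff coeff_map_poly)
  then show ?case using pCons.IH
    by (simp add: map_poly_of_real_add map_poly_pCons)
qed simp

lemma of_real_poly_Khat:
  "poly (map_poly of_real (Khat n x)) c = Khat n (\<lambda>j. poly (map_poly of_real (x j)) c)"
  for c :: complex
proof -
  have s: "poly (map_poly of_real (\<Sum>a\<in>A. f a)) c = (\<Sum>a\<in>A. poly (map_poly of_real (f a)) c)"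
    for A :: "'b set" and f :: "'b \<Rightarrow> real poly"
    by (induction A rule: infinite_finite_induct) (auto simp: map_poly_of_real_add)
  have p: "poly (map_poly of_real (\<Prod>a\<in>A. f a)) c = (\<Prod>a\<in>A. poly (map_poly of_real (f a)) c)"
    for A :: "'b set" and f :: "'b \<Rightarrow> real poly"
    by (induction A rule: infinite_finite_induct) (auto simp: map_poly_of_real_mult)
  show ?thesis by (simp add: Khat_def s p)
qed

lemma degree_Khat_linear:
  fixes x :: "nat \<Rightarrow> 'a::comm_ring_1 poly"
  assumes "\<And>j. degree (x j) \<le> 1"
  shows "2 * degree (Khat n x) \<le> n - 1"
proof -
  have "degree (Khat n x) \<le> (n - 1) div 2"
    unfolding Khat_peak_set
  proof (rule degree_sum_le)
    fix \<pi>
    have "degree (\<Prod>i\<in>peak_set n \<pi>. x (\<pi> i)) \<le> sum (degree \<circ> (\<lambda>i. x (\<pi> i))) (peak_set n \<pi>)"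
      by (rule degree_prod_sum_le) simp
    also have "\<dots> \<le> (\<Sum>i\<in>peak_set n \<pi>. 1)"
      by (rule sum_mono) (simp only: o_apply assms)
    also have "\<dots> \<le> (n - 1) div 2"
      using card_peak_set[of n \<pi>] by simp
    finally show "degree (\<Prod>i\<in>peak_set n \<pi>. x (\<pi> i)) \<le> (n - 1) div 2" .
  qed (simp add: finite_permutations)
  then show ?thesis by linarith
qed

text \<open>
  The operator \<open>\<Sum>\<^sub>j (x\<^sub>j - 1) \<partial>\<^sub>j\<close> produced by the insertion of the maximum is the derivative, at \<open>s = 1\<close>, of the
  dilation with centre \<open>(1, \<dots>, 1)\<close>; hence it is governed by the zeros of a polynomial in \<open>s\<close>.
\<close>

definition Khat_dilate :: "nat \<Rightarrow> (nat \<Rightarrow> 'a::idom) \<Rightarrow> 'a poly" where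
  "Khat_dilate n x = Khat n (\<lambda>j. [:1, x j - 1:])"

lemma poly_Khat_dilate: "poly (Khat_dilate n x) s = Khat n (\<lambda>j. 1 + s * (x j - 1))"
  by (simp add: Khat_dilate_def poly_Khat)

lemma degree_Khat_dilate: "2 * degree (Khat_dilate n x) \<le> n - 1"
  unfolding Khat_dilate_def by (rule degree_Khat_linear) simp

text \<open>At \<open>s = 1\<close> the factor \<open>1 + s * (x j - 1)\<close> has value
  \<open>x j\<close> and derivative \<open>x j - 1\<close>, so the product rule yields the double
  sum of \<open>Khat_Suc\<close>.\<close>

lemma Khat_Suc_pderiv:
  fixes x :: "nat \<Rightarrow> 'a::idom"
  assumes "n \<ge> 1"
  shows "Khat (Suc n) x = 2 * Khat n x + x (Suc n) *
    (of_nat (n - 1) * Khat n x - 2 * poly (pderiv (Khat_dilate n x)) 1)"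
proof -
  have "poly (pderiv (Khat_dilate n x)) 1 = (\<Sum>\<pi> | \<pi> permutes {1..n}. \<Sum>p\<in>peak_set n \<pi>.
      (x (\<pi> p) - 1) * (\<Prod>i\<in>peak_set n \<pi> - {p}. x (\<pi> i)))"
    unfolding Khat_dilate_def Khat_peak_set
    by (simp add: higher_pderiv_sum[of 1, simplified] pderiv_prod poly_sum poly_prod pderiv_pCons mult.commute)
  then show ?thesis using Khat_Suc[OF assms, of x] by simp
qed

text \<open>The logarithmic derivative at 1 is the sum over the zeros \<open>s\<close> of
  \<open>1 / (1 - s) = 1 + s / (1 - s)\<close>. The ones add up to the degree, which leaves minus
  the sum of the terms \<open>b * s / (1 - s)\<close>. The induction splits off one zero at a
  time.\<close>

lemma Re_log_deriv_nonneg: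
  fixes p :: "complex poly"
  assumes "poly p 1 \<noteq> 0" and "\<And>s. poly p s = 0 \<Longrightarrow> Re (b * s / (1 - s)) \<le> 0"
  shows "Re (b * (of_nat (degree p) - poly (pderiv p) 1 / poly p 1)) \<ge> 0"
  using assms
proof (induction "degree p" arbitrary: p)
  case 0
  then obtain c where "p = [:c:]" by (metis degree_eq_zeroE)
  then show ?case by (simp add: pderiv_pCons)
next
  case (Suc d)
  then have "\<not> constant (poly p)" by (simp add: constant_degree)
  then obtain s where s: "poly p s = 0" using fundamental_theorem_of_algebra by blast
  then obtain q where q: "p = [:-s, 1:] * q" by (meson dvdE poly_eq_0_iff_dvd)
  then have q1: "poly q 1 \<noteq> 0" and s1: "s \<noteq> 1" using Suc.prems(1) by auto
  then have "q \<noteq> 0" by auto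
  then have deg: "degree p = Suc (degree q)"
    unfolding q by (subst degree_mult_eq) auto
  have IH: "Re (b * (of_nat (degree q) - poly (pderiv q) 1 / poly q 1)) \<ge> 0"
    using Suc.hyps deg Suc.prems(2) q1 by (auto simp: q)
  have "poly (pderiv p) 1 / poly p 1 = 1 / (1 - s) + poly (pderiv q) 1 / poly q 1"
    unfolding q pderiv_mult using q1 s1 by (simp add: pderiv_pCons field_simps)
  moreover have "1 / (1 - s) = 1 + s / (1 - s)"
    using s1 by (simp add: field_simps)
  ultimately have "b * (of_nat (degree p) - poly (pderiv p) 1 / poly p 1) =
      b * (of_nat (degree q) - poly (pderiv q) 1 / poly q 1) - b * s / (1 - s)"
    unfolding deg by (simp add: algebra_simps)
  then show ?case using IH Suc.prems(2)[OF s] by simp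
qed

text \<open>
  If \<open>s\<close> is a zero of the dilation polynomial violating the hypothesis of the previous lemma, then the points
  \<open>1 + s (x\<^sub>j - 1)\<close> lie in another half-plane through \<open>0\<close> that contains \<open>1\<close>, namely the one with normal
  \<open>1 / w + a\<close>, where \<open>w = s / (a (1 - s))\<close>.
\<close>

lemma Khat_log_deriv_halfplane:
  fixes x :: "nat \<Rightarrow> complex"
  assumes nz: "\<And>a x. Re a > 0 \<Longrightarrow> (\<And>j. j \<in> {1..n} \<Longrightarrow> Re (a * x j) > 0) \<Longrightarrow> Khat n x \<noteq> 0"
    and a: "Re a > 0" and x: "\<And>j. j \<in> {1..n} \<Longrightarrow> Re (a * x j) > 0"
  shows "Re ((of_nat (n - 1) / 2 - poly (pderiv (Khat_dilate n x)) 1 / Khat n x) / a) \<ge> 0"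
proof -
  let ?p = "Khat_dilate n x"
  have p1: "poly ?p 1 = Khat n x" by (simp add: poly_Khat_dilate)
  have p1nz: "poly ?p 1 \<noteq> 0" unfolding p1 using nz a x by blast
  have a0: "a \<noteq> 0" using a by auto
  have Re_inverse: "Re (1 / z) > 0" if "Re z > 0" for z
    using that by (auto simp: Re_divide complex_eq_iff sum_power2_gt_zero_iff intro!: divide_pos_pos)
  have "Re (1 / a * (of_nat (degree ?p) - poly (pderiv ?p) 1 / poly ?p 1)) \<ge> 0"
  proof (rule Re_log_deriv_nonneg[OF p1nz])
    fix s assume s: "poly ?p s = 0"
    then have s1: "s \<noteq> 1" using p1nz by auto
    show "Re (1 / a * s / (1 - s)) \<le> 0"
    proof (rule ccontr)
      assume "\<not> ?thesis"
      moreover define w where "w = s / (a * (1 - s))"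
      ultimately have w: "Re w > 0" by (simp add: field_simps)
      then have s0: "s \<noteq> 0" by (auto simp: w_def)
      have "1 / w + a = a / s"
        using s0 a0 s1 unfolding w_def by (simp add: field_simps)
      have "Khat n (\<lambda>j. 1 + s * (x j - 1)) \<noteq> 0"
      proof (rule nz[where a = "1 / w + a"])
        show "Re (1 / w + a) > 0" using Re_inverse[OF w] a by simp
        fix j assume j: "j \<in> {1..n}"
        have "(1 / w + a) * (1 + s * (x j - 1)) = 1 / w + a * x j"
          unfolding \<open>1 / w + a = a / s\<close> using s0 a0 s1 unfolding w_def by (simp add: field_simps)
        then show "Re ((1 / w + a) * (1 + s * (x j - 1))) > 0"
          using Re_inverse[OF w] x[OF j] by simp
      qed
      then show False using s by (simp add: poly_Khat_dilate)
    qed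
  qed
  \<comment> \<open>\<open>(n - 1) / 2\<close> is at least the degree, and the surplus enters as a
    nonnegative multiple of \<open>1 / a\<close>, whose real part is positive.\<close>
  moreover have "Re (1 / a * of_real (real (n - 1) / 2 - real (degree ?p))) \<ge> 0"
  proof -
    have "real (2 * degree ?p) \<le> real (n - 1)"
      by (simp only: of_nat_le_iff degree_Khat_dilate)
    then have "real (n - 1) / 2 - real (degree ?p) \<ge> 0" by simp
    moreover have "Re (1 / a * of_real r) = Re (1 / a) * r" for r
      by (subst times_complex.sel) simp
    ultimately show ?thesis using Re_inverse[OF a] by (metis mult_nonneg_nonneg less_imp_le)
  qed
  moreover have "(of_nat (n - 1) / 2 - poly (pderiv ?p) 1 / Khat n x) / a =
      1 / a * (of_nat (degree ?p) - poly (pderiv ?p) 1 / poly ?p 1) +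
      1 / a * of_real (real (n - 1) / 2 - real (degree ?p))"
    unfolding p1 by (simp add: diff_divide_distrib)
  ultimately show ?thesis by simp
qed

lemma Khat_Suc_factor:
  fixes x :: "nat \<Rightarrow> complex"
  assumes "n \<ge> 1" and "Khat n x \<noteq> 0"
  shows "Khat (Suc n) x = 2 * Khat n x *
    (1 + x (Suc n) * (of_nat (n - 1) / 2 - poly (pderiv (Khat_dilate n x)) 1 / Khat n x))"
  unfolding Khat_Suc_pderiv[OF assms(1)] using assms(2) by (simp add: field_simps)

text \<open>The induction keeps \<open>a\<close> arbitrary: the step for one half-plane uses the
  hypothesis for the other half-planes produced by the dilation.\<close>

lemma Khat_nonzero_halfplane:
  fixes x :: "nat \<Rightarrow> complex"
  assumes "n \<ge> 1" and "Re a > 0" and "\<And>j. j \<in> {1..n} \<Longrightarrow> Re (a * x j) > 0"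
  shows "Khat n x \<noteq> 0"
  using assms
proof (induction n arbitrary: a x rule: dec_induct)
  case base
  then show ?case by (simp add: Khat_1)
next
  case (step n)
  let ?v = "of_nat (n - 1) / 2 - poly (pderiv (Khat_dilate n x)) 1 / Khat n x"
  have nz: "Khat n x \<noteq> 0"
    by (rule step.IH[OF step.prems(1)]) (use step.prems(2) in auto)
  have v: "Re (?v / a) \<ge> 0"
    by (rule Khat_log_deriv_halfplane[OF step.IH step.prems(1)]) (use step.prems(2) in auto)
  have ax: "Re (a * x (Suc n)) > 0" using step.prems(2) by auto
  then have x0: "x (Suc n) \<noteq> 0" "a \<noteq> 0" by auto
  show ?case
  proof
    assume "Khat (Suc n) x = 0"
    then have "1 + x (Suc n) * ?v = 0"
      using Khat_Suc_factor[OF step.hyps(1) nz] nz by simp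
    then have "?v / a * (a * x (Suc n)) = -1"
      using x0 by (simp add: add_eq_0_iff mult.commute) 
    then have "?v / a = - (1 / (a * x (Suc n)))"
      using x0 by (simp add: field_simps)
    moreover have "Re (1 / (a * x (Suc n))) > 0"
      using ax by (auto simp: Re_divide complex_eq_iff sum_power2_gt_zero_iff intro!: divide_pos_pos)
    ultimately show False using v by simp
  qed
qed

section \<open>Limits of half-planes\<close>

lemma eventually_at_right_0_pos_add_mult:
  fixes c d :: real
  assumes "c > 0"
  shows "eventually (\<lambda>e. c + e * d > 0) (at_right 0)"
proof -
  have "((\<lambda>e. c + e * d) \<longlongrightarrow> c + 0 * d) (at_right 0)" by (intro tendsto_intros)
  then show ?thesis using assms by (auto dest: order_tendstoD(1))
qed

text \<open>For \<open>a = e - i\<close>, \<open>Re (a * z) = Im z + e * Re z\<close>. As there are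
  finitely many coordinates, one small \<open>e > 0\<close> makes all of these positive.\<close>

lemma Khat_nonzero_upper:
  fixes x :: "nat \<Rightarrow> complex"
  assumes n: "n \<ge> 1" and x: "\<And>j. j \<in> {1..n} \<Longrightarrow> Im (x j) > 0"
  shows "Khat n x \<noteq> 0"
proof -
  have "eventually (\<lambda>e. \<forall>j\<in>{1..n}. Im (x j) + e * Re (x j) > 0) (at_right 0)"
    by (intro eventually_ball_finite finite_atLeastAtMost ballI eventually_at_right_0_pos_add_mult x)
  moreover have "eventually (\<lambda>e::real. e > 0) (at_right 0)"
    by (rule eventually_at_right_less)
  ultimately have "eventually (\<lambda>e. e > 0 \<and> (\<forall>j\<in>{1..n}. Im (x j) + e * Re (x j) > 0)) (at_right 0)"
    by eventually_elim auto
  then obtain e where e: "e > 0" "\<And>j. j \<in> {1..n} \<Longrightarrow> Im (x j) + e * Re (x j) > 0"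
    using eventually_happens'[OF trivial_limit_at_right_real] by blast
  show ?thesis
    by (rule Khat_nonzero_halfplane[OF n, of "Complex e (-1)"]) (use e in \<open>auto simp: add.commute\<close>)
qed

lemma Im_Khat_ratio_nonneg:
  fixes l :: "nat \<Rightarrow> real"
  assumes n: "n \<ge> 1" and l: "\<And>j. j \<ge> 1 \<Longrightarrow> l j > 0" and t: "Im t > 0"
  shows "Im (Khat (Suc n) (\<lambda>j. t * l j) / Khat n (\<lambda>j. t * l j)) \<ge> 0"
proof -
  let ?x = "\<lambda>j. t * complex_of_real (l j)"
  let ?v = "of_nat (n - 1) / 2 - poly (pderiv (Khat_dilate n ?x)) 1 / Khat n ?x"
  have t0: "t \<noteq> 0" using t by auto
  have nz: "Khat n ?x \<noteq> 0"
    by (rule Khat_nonzero_upper[OF n]) (use l t in auto)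
  have "eventually (\<lambda>e. e > 0 \<and> Im t + e * Re t > 0) (at_right 0)"
    using eventually_at_right_less[of 0] eventually_at_right_0_pos_add_mult[OF t, of "Re t"]
    by eventually_elim auto
  then have ev: "eventually (\<lambda>e. Im (t * ?v) + e * Re (t * ?v) \<ge> 0) (at_right 0)"
  proof eventually_elim
    case (elim e)
    \<comment> \<open>With normal \<open>1 / b\<close> the factor \<open>t\<close> cancels:
      \<open>1 / b * ?x j = l j / (e - i)\<close> has real part \<open>l j * e / (e^2 + 1)\<close>,
      positive for \<open>e > 0\<close>. The resulting bound \<open>Re (b * ?v) \<ge> 0\<close>
      becomes \<open>Im (t * ?v) \<ge> 0\<close> as \<open>e\<close> tends to 0.\<close>
    define b where "b = Complex e (-1) * t"
    have b: "Re b > 0" using elim by (simp add: b_def add.commute)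
    then have b0: "b \<noteq> 0" by auto
    have "Complex e (-1) \<noteq> 0" using elim by (auto simp: complex_eq_iff)
    have "Re (?v / (1 / b)) \<ge> 0"
    proof (rule Khat_log_deriv_halfplane)
      show "Khat n x \<noteq> 0" if "Re a > 0" "\<And>j. j \<in> {1..n} \<Longrightarrow> Re (a * x j) > 0" for a x
        using Khat_nonzero_halfplane[OF n that] .
      show "Re (1 / b) > 0"
        using b by (auto simp: Re_divide complex_eq_iff sum_power2_gt_zero_iff intro!: divide_pos_pos)
      fix j assume "j \<in> {1..n}"
      then have "l j > 0" using l by simp
      moreover have "1 / b * ?x j = l j / Complex e (-1)"
        using t0 by (simp add: b_def)
      ultimately show "Re (1 / b * ?x j) > 0"
        using elim by (simp add: Re_divide add_pos_nonneg)
    qed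
    then have "Re (Complex e (-1) * (t * ?v)) \<ge> 0"
      unfolding b_def by (simp only: divide_divide_eq_right div_by_1 ac_simps)
    then show ?case by (simp only: times_complex.sel complex.sel) simp
  qed
  have "((\<lambda>e. Im (t * ?v) + e * Re (t * ?v)) \<longlongrightarrow> Im (t * ?v) + 0 * Re (t * ?v)) (at_right 0)"
    by (intro tendsto_intros)
  then have "Im (t * ?v) \<ge> 0"
    using tendsto_lowerbound[OF _ ev] trivial_limit_at_right_real by fastforce
  moreover have "2 * Khat n ?x * y / Khat n ?x = 2 * y" for y
    using nz by simp
  then have "Khat (Suc n) ?x / Khat n ?x = 2 + of_real (2 * l (Suc n)) * (t * ?v)"
    unfolding Khat_Suc_factor[OF n nz] by (simp only:) (simp add: algebra_simps)
  ultimately show ?thesis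
    using l[of "Suc n"] by (simp add: mult_nonneg_nonneg del: Im_complex_div_ge_0)
qed

section \<open>Interlacing from the sign of the imaginary part\<close>

lemma real_rooted_mult_right:
  assumes "real_rooted (p * q)"
  shows "real_rooted q"
  using assms by (auto simp: real_rooted_def map_poly_of_real_mult)

lemma poly_map_poly_of_real [simp]:
  "poly (map_poly of_real p) (of_real x) = (of_real (poly p x) :: 'a::{real_algebra_1,comm_ring_1})"
  by (induction p) (simp_all add: map_poly_pCons)

lemma degree_map_poly_of_real [simp]:
  "degree (map_poly (of_real :: real \<Rightarrow> 'a::real_algebra_1) p) = degree p"
  by (rule degree_map_poly) simp

lemma real_rooted_decompose:
  assumes "real_rooted p" "p \<noteq> 0"
  shows "p = smult (lead_coeff p) (\<Prod>x\<in>#proots p. [:-x, 1:])"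
    and "size (proots p) = degree p"
proof -
  have "p = smult (lead_coeff p) (\<Prod>x\<in>#proots p. [:-x, 1:]) \<and> size (proots p) = degree p"
    using assms
  proof (induction "degree p" arbitrary: p)
    case 0
    then obtain c where "p = [:c:]" by (metis degree_eq_zeroE)
    then show ?case by simp
  next
    case (Suc d)
    then have "degree (map_poly complex_of_real p) \<noteq> 0" by simp
    then obtain z where z: "poly (map_poly complex_of_real p) z = 0"
      using fundamental_theorem_of_algebra constant_degree by metis
    then have "z \<in> \<real>" using Suc.prems(1) by (simp add: real_rooted_def)
    then obtain r where "z = of_real r" by (elim Reals_cases)
    with z have "poly p r = 0" by simp
    then obtain q where q: "p = [:-r, 1:] * q" by (meson dvdE poly_eq_0_iff_dvd)
    then have q0: "q \<noteq> 0" using Suc.prems by auto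
    have deg: "degree p = Suc (degree q)"
      using q0 unfolding q by (subst degree_mult_eq) auto
    have "real_rooted q" using Suc.prems(1) unfolding q by (rule real_rooted_mult_right)
    then have IH: "q = smult (lead_coeff q) (\<Prod>x\<in>#proots q. [:-x, 1:])" "size (proots q) = degree q"
      using Suc.hyps(1)[OF _ _ q0] Suc.hyps(2) deg by simp_all
    have pr: "proots p = add_mset r (proots q)"
      using q0 unfolding q by (subst proots_mult) auto
    have lc: "lead_coeff p = lead_coeff q"
      unfolding q by (simp only: lead_coeff_mult) simp
    have "p = [:-r, 1:] * smult (lead_coeff q) (\<Prod>x\<in>#proots q. [:-x, 1:])"
      using IH(1) q by (simp only:)
    also have "\<dots> = smult (lead_coeff p) (\<Prod>x\<in>#proots p. [:-x, 1:])"
      unfolding pr lc by (simp only: image_mset_add_mset prod_mset.add_mset mult_smult_right)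
    finally have "p = smult (lead_coeff p) (\<Prod>x\<in>#proots p. [:-x, 1:])" .
    moreover have "size (proots p) = degree p" using pr IH(2) deg by simp
    ultimately show ?case ..
  qed
  then show "p = smult (lead_coeff p) (\<Prod>x\<in>#proots p. [:-x, 1:])"
    and "size (proots p) = degree p" by auto
qed

lemma poly_of_real_prod_roots:
  "poly (map_poly of_real (\<Prod>x\<in>#M. [:-x, 1:])) z = (\<Prod>x\<in>#M. z - complex_of_real x)"
  by (induction M) (auto simp: map_poly_of_real_mult map_poly_pCons simp del: mult_pCons_left)

lemma real_rooted_eval:
  assumes "real_rooted p" "p \<noteq> 0"
  shows "poly (map_poly of_real p) z = of_real (lead_coeff p) * (\<Prod>x\<in>#proots p. z - complex_of_real x)"
proof -
  have "map_poly of_real (smult a q) = smult (of_real a :: complex) (map_poly of_real q)" for a q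
    by (simp add: poly_eq_iff coeff_map_poly)
  then show ?thesis
    by (subst real_rooted_decompose(1)[OF assms]) (simp add: poly_of_real_prod_roots)
qed

text \<open>An argument of \<open>c + i s - x\<close> that is continuous in \<open>s > 0\<close>.\<close>

definition ray_arg :: "real \<Rightarrow> real \<Rightarrow> real \<Rightarrow> real" where
  "ray_arg c s x = pi / 2 - arctan ((c - x) / s)"

text \<open>With \<open>y = (c - x) / s\<close>, the number is \<open>s * (y + i)\<close>, and
  \<open>y + i\<close> has modulus \<open>sqrt (1 + y^2)\<close> and argument
  \<open>pi / 2 - arctan y\<close>.\<close>

lemma ray_arg:
  assumes "s > 0"
  shows "\<exists>r>0. Complex c s - of_real x = of_real r * cis (ray_arg c s x)"
proof (intro exI conjI)
  let ?y = "(c - x) / s"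
  have pos: "sqrt (1 + ?y\<^sup>2) > 0" by (simp add: add_pos_nonneg)
  then show "s * sqrt (1 + ?y\<^sup>2) > 0" using assms by simp
  have "cis (ray_arg c s x) = Complex (?y / sqrt (1 + ?y\<^sup>2)) (1 / sqrt (1 + ?y\<^sup>2))"
    by (simp add: ray_arg_def complex_eq_iff cos_diff sin_diff sin_arctan cos_arctan)
  then show "Complex c s - of_real x = of_real (s * sqrt (1 + ?y\<^sup>2)) * cis (ray_arg c s x)"
    using pos assms by (simp add: complex_eq_iff)
qed

text \<open>Arguments are added without reduction modulo \<open>2 * pi\<close>, so that their sum
  stays continuous in \<open>s\<close>.\<close>

lemma ray_arg_prod:
  assumes "s > 0"
  shows "\<exists>r>0. (\<Prod>x\<in>#M. Complex c s - of_real x) = of_real r * cis (\<Sum>x\<in>#M. ray_arg c s x)"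
proof (induction M)
  case empty
  show ?case by (rule exI[of _ 1]) simp
next
  case (add x M)
  then obtain r where "r > 0" "(\<Prod>x\<in>#M. Complex c s - of_real x) = of_real r * cis (\<Sum>x\<in>#M. ray_arg c s x)"
    by blast
  moreover obtain r' where "r' > 0" "Complex c s - of_real x = of_real r' * cis (ray_arg c s x)"
    using ray_arg[OF assms] by blast
  ultimately show ?case
    by (intro exI[of _ "r' * r"]) (simp add: cis_mult[symmetric])
qed

section \<open>Continuity and limits of the argument along the ray\<close>

lemma tendsto_sum_mset:
  fixes f :: "'a \<Rightarrow> 'b \<Rightarrow> 'c::topological_comm_monoid_add"
  assumes "\<And>x. x \<in># M \<Longrightarrow> ((\<lambda>s. f s x) \<longlongrightarrow> l x) F"
  shows "((\<lambda>s. \<Sum>x\<in>#M. f s x) \<longlongrightarrow> (\<Sum>x\<in>#M. l x)) F"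
  using assms by (induction M) (auto intro!: tendsto_add)

lemma continuous_on_ray_arg: "continuous_on {0<..} (\<lambda>s. ray_arg c s x)"
  unfolding ray_arg_def by (intro continuous_intros) auto

lemma tendsto_ray_arg_at_top: "((\<lambda>s. ray_arg c s x) \<longlongrightarrow> pi / 2) at_top"
proof -
  have "((\<lambda>s. (c - x) / s) \<longlongrightarrow> 0) at_top"
    by (intro tendsto_divide_0[OF tendsto_const] filterlim_at_top_imp_at_infinity filterlim_ident)
  then have "((\<lambda>s. pi / 2 - arctan ((c - x) / s)) \<longlongrightarrow> pi / 2 - arctan 0) at_top"
    by (intro tendsto_intros)
  then show ?thesis by (simp add: ray_arg_def)
qed

lemma tendsto_ray_arg_at_right_0:
  assumes "x \<noteq> c"
  shows "((\<lambda>s. ray_arg c s x) \<longlongrightarrow> (if x > c then pi else 0)) (at_right 0)"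
proof (cases "x > c")
  case True
  then have "filterlim (\<lambda>s. (c - x) * inverse s) at_bot (at_right 0)"
    by (intro filterlim_tendsto_neg_mult_at_bot[OF tendsto_const _ filterlim_inverse_at_top_right]) simp
  then have "((\<lambda>s. arctan ((c - x) / s)) \<longlongrightarrow> - (pi / 2)) (at_right 0)"
    by (intro filterlim_compose[OF tendsto_arctan_at_bot]) (simp add: divide_inverse)
  then have "((\<lambda>s. pi / 2 - arctan ((c - x) / s)) \<longlongrightarrow> pi / 2 - - (pi / 2)) (at_right 0)"
    by (intro tendsto_intros)
  then show ?thesis using True by (simp add: ray_arg_def)
next
  case False
  then have "filterlim (\<lambda>s. (c - x) * inverse s) at_top (at_right 0)"
    using assms
    by (intro filterlim_tendsto_pos_mult_at_top[OF tendsto_const _ filterlim_inverse_at_top_right]) simp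
  then have "((\<lambda>s. arctan ((c - x) / s)) \<longlongrightarrow> pi / 2) (at_right 0)"
    by (intro filterlim_compose[OF tendsto_arctan_at_top]) (simp add: divide_inverse)
  then have "((\<lambda>s. pi / 2 - arctan ((c - x) / s)) \<longlongrightarrow> pi / 2 - pi / 2) (at_right 0)"
    by (intro tendsto_intros)
  then show ?thesis using False by (simp add: ray_arg_def)
qed

lemma sin_neg_between:
  fixes k :: int
  assumes "(2 * k + 1) * pi < y" "y < (2 * k + 2) * pi"
  shows "sin y < 0"
proof -
  define w where "w = y - (2 * k + 1) * pi"
  have w: "0 < w" "w < pi" using assms by (simp_all add: w_def algebra_simps)
  have "y = (w + pi) + 2 * pi * of_int k" by (simp add: w_def algebra_simps)
  then have "sin y = sin ((w + pi) + 2 * pi * of_int k)" by (rule arg_cong)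
  also have "\<dots> = - sin w"
    unfolding sin_add[of "w + pi"] cos_int_2pin sin_int_2pin by simp
  finally show ?thesis using sin_gt_zero[OF w] by simp
qed

text \<open>
  The set where \<open>sin\<close> is nonnegative is a disjoint union of closed intervals, so a continuous function
  with values in it stays in one of them, and so do its limits.
\<close>

lemma sin_nonneg_same_period:
  fixes D :: "real \<Rightarrow> real"
  assumes cont: "continuous_on {0<..} D" and sin: "\<And>s. s > 0 \<Longrightarrow> sin (D s) \<ge> 0"
    and lim0: "(D \<longlongrightarrow> a) (at_right 0)" and lim1: "(D \<longlongrightarrow> b) at_top"
  obtains k :: int where "2 * k * pi \<le> a" "a \<le> (2 * k + 1) * pi" "2 * k * pi \<le> b" "b \<le> (2 * k + 1) * pi"
proof -
  \<comment> \<open>The base point \<open>s = 1\<close> selects the period of length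
    \<open>2 * pi\<close> containing \<open>D 1\<close>; nonnegativity of the sine puts
    \<open>D 1\<close> in its first half.\<close>
  define k where "k = \<lfloor>D 1 / (2 * pi)\<rfloor>"
  have "of_int k \<le> D 1 / (2 * pi)" "D 1 / (2 * pi) < of_int k + 1"
    unfolding k_def by linarith+
  then have k: "2 * k * pi \<le> D 1" "D 1 < (2 * k + 2) * pi"
    by (simp_all add: field_simps)
  have D1: "D 1 \<le> (2 * k + 1) * pi"
    using sin_neg_between[of k "D 1"] k(2) sin[of 1] by force
  have conn: "y \<in> D ` {0<..}" if "s > 0" "D s \<le> y \<and> y \<le> D 1 \<or> D 1 \<le> y \<and> y \<le> D s" for s y
  proof -
    have "connected (D ` {0<..})" by (rule connected_continuous_image[OF cont]) simp
    moreover have "D s \<in> D ` {0<..}" "D 1 \<in> D ` {0<..}" using that(1) by auto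
    ultimately show ?thesis using that(2) by (meson connectedD_interval)
  qed
  have upper: "D s \<le> (2 * k + 1) * pi" if s: "s > 0" for s
  proof (rule ccontr)
    assume "\<not> ?thesis"
    moreover have "(2 * k + 1) * pi < (2 * k + 2) * pi" by simp
    \<comment> \<open>Leaving the interval would force a value in the adjacent gap, where the sine
      is negative; the minimum keeps \<open>y\<close> inside that gap.\<close>
    ultimately obtain y where y: "(2 * k + 1) * pi < y" "y < min (D s) ((2 * k + 2) * pi)"
      using dense[of "(2 * k + 1) * pi" "min (D s) ((2 * k + 2) * pi)"] by auto
    then have "y \<in> D ` {0<..}" using D1 by (intro conn[OF s]) auto
    then show False using sin_neg_between[of k y] y sin by force
  qed
  have lower: "2 * k * pi \<le> D s" if s: "s > 0" for s
  proof (rule ccontr)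
    assume "\<not> ?thesis"
    moreover have "(2 * k - 1) * pi < 2 * k * pi" by simp
    ultimately obtain y where y: "max (D s) ((2 * k - 1) * pi) < y" "y < 2 * k * pi"
      using dense[of "max (D s) ((2 * k - 1) * pi)" "2 * k * pi"] by auto
    then have "y \<in> D ` {0<..}" using k(1) by (intro conn[OF s]) auto
    then show False using sin_neg_between[of "k - 1" y] y sin by (force simp: algebra_simps)
  qed
  have ev0: "eventually (\<lambda>s::real. s > 0) (at_right 0)" by (rule eventually_at_right_less)
  have ev1: "eventually (\<lambda>s::real. s > 0) at_top" by (rule eventually_gt_at_top)
  show ?thesis
  proof
    show "2 * k * pi \<le> a" by (rule tendsto_lowerbound[OF lim0 eventually_mono[OF ev0 lower]]) auto
    show "a \<le> (2 * k + 1) * pi" by (rule tendsto_upperbound[OF lim0 eventually_mono[OF ev0 upper]]) auto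
    show "2 * k * pi \<le> b" by (rule tendsto_lowerbound[OF lim1 eventually_mono[OF ev1 lower]]) auto
    show "b \<le> (2 * k + 1) * pi" by (rule tendsto_upperbound[OF lim1 eventually_mono[OF ev1 upper]]) auto
  qed
qed

text \<open>Near the real axis a root contributes \<open>pi\<close> or 0 to the argument according
  to whether it exceeds \<open>c\<close>; far up it contributes \<open>pi / 2\<close>. Both limits
  lie in the same interval, so one \<open>k\<close> serves root counts and degrees, the latter with
  doubled bounds.\<close>

lemma root_count_same_period:
  fixes f g :: "real poly"
  assumes f: "real_rooted f" "lead_coeff f > 0" and g: "real_rooted g" "lead_coeff g > 0"
    and Im: "\<And>z. Im z > 0 \<Longrightarrow> Im (poly (map_poly of_real f) z / poly (map_poly of_real g) z) \<ge> 0"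
    and c: "poly f c \<noteq> 0" "poly g c \<noteq> 0"
  obtains k :: int where
    "2 * k \<le> int (size {#x\<in>#proots f. x > c#}) - int (size {#x\<in>#proots g. x > c#})"
    "int (size {#x\<in>#proots f. x > c#}) - int (size {#x\<in>#proots g. x > c#}) \<le> 2 * k + 1"
    "4 * k \<le> int (degree f) - int (degree g)" "int (degree f) - int (degree g) \<le> 4 * k + 2"
proof -
  have f0: "f \<noteq> 0" and g0: "g \<noteq> 0" using f g by auto
  define T where "T p s = (\<Sum>x\<in>#proots p. ray_arg c s x)" for p s
  have cont: "continuous_on {0<..} (T p)" for p
  proof -
    have "continuous_on {0<..} (\<lambda>s. \<Sum>x\<in>#M. ray_arg c s x)" for M
      by (induction M) (auto intro!: continuous_intros continuous_on_ray_arg)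
    then show ?thesis by (simp add: T_def[abs_def])
  qed
  have at_top: "(T p \<longlongrightarrow> real (size (proots p)) * (pi / 2)) at_top" for p
    using tendsto_sum_mset[of "proots p" "ray_arg c" "\<lambda>_. pi / 2" at_top] tendsto_ray_arg_at_top
    by (simp add: T_def[abs_def])
  have at_0: "(T p \<longlongrightarrow> real (size {#x\<in>#proots p. x > c#}) * pi) (at_right 0)"
    if "p \<noteq> 0" "poly p c \<noteq> 0" for p
  proof -
    have "(\<Sum>x\<in>#M. if x > c then pi else 0) = real (size {#x\<in>#M. x > c#}) * pi" for M
      by (induction M) (auto simp: algebra_simps)
    moreover have "(T p \<longlongrightarrow> (\<Sum>x\<in>#proots p. if x > c then pi else 0)) (at_right 0)"
      unfolding T_def[abs_def]
      by (intro tendsto_sum_mset tendsto_ray_arg_at_right_0) (use that in auto)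
    ultimately show ?thesis by simp
  qed
  have sin: "sin (T f s - T g s) \<ge> 0" if s: "s > 0" for s
  proof -
    obtain r where r: "r > 0" "(\<Prod>x\<in>#proots f. Complex c s - of_real x) = of_real r * cis (T f s)"
      using ray_arg_prod[OF s] unfolding T_def by blast
    obtain q where q: "q > 0" "(\<Prod>x\<in>#proots g. Complex c s - of_real x) = of_real q * cis (T g s)"
      using ray_arg_prod[OF s] unfolding T_def by blast
    \<comment> \<open>The leading coefficients are positive, so the quotient is a positive multiple
      of \<open>cis (T f s - T g s)\<close>.\<close>
    have "poly (map_poly of_real f) (Complex c s) / poly (map_poly of_real g) (Complex c s) =
        of_real (lead_coeff f * r / (lead_coeff g * q)) * cis (T f s - T g s)"
      unfolding real_rooted_eval[OF f(1) f0] real_rooted_eval[OF g(1) g0] r q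
      by (simp add: cis_divide[symmetric] mult.assoc)
    then have "lead_coeff f * r / (lead_coeff g * q) * sin (T f s - T g s) \<ge> 0"
      using Im[of "Complex c s"] s by simp
    moreover have "lead_coeff f * r / (lead_coeff g * q) > 0"
      using f g r q by simp
    ultimately show ?thesis by (simp only: zero_le_mult_iff) linarith
  qed
  obtain k :: int where k:
    "2 * k * pi \<le> real (size {#x\<in>#proots f. x > c#}) * pi - real (size {#x\<in>#proots g. x > c#}) * pi"
    "real (size {#x\<in>#proots f. x > c#}) * pi - real (size {#x\<in>#proots g. x > c#}) * pi \<le> (2 * k + 1) * pi"
    "2 * k * pi \<le> real (degree f) * (pi / 2) - real (degree g) * (pi / 2)"
    "real (degree f) * (pi / 2) - real (degree g) * (pi / 2) \<le> (2 * k + 1) * pi"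
  proof (rule sin_nonneg_same_period[of "\<lambda>s. T f s - T g s"])
    show "continuous_on {0<..} (\<lambda>s. T f s - T g s)" by (intro continuous_intros cont)
    show "((\<lambda>s. T f s - T g s) \<longlongrightarrow> real (size {#x\<in>#proots f. x > c#}) * pi -
        real (size {#x\<in>#proots g. x > c#}) * pi) (at_right 0)"
      by (intro tendsto_diff at_0 f0 g0 c)
    show "((\<lambda>s. T f s - T g s) \<longlongrightarrow> real (degree f) * (pi / 2) - real (degree g) * (pi / 2)) at_top"
      using tendsto_diff[OF at_top[of f] at_top[of g]]
      by (simp add: real_rooted_decompose(2) f f0 g g0)
  qed (use sin in auto)
  have cancel: "x * pi \<le> y * pi \<longleftrightarrow> x \<le> y" for x y :: real by simp
  show ?thesis
  proof
    show "2 * k \<le> int (size {#x\<in>#proots f. x > c#}) - int (size {#x\<in>#proots g. x > c#})"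
      using k(1) unfolding left_diff_distrib[symmetric] cancel by linarith
    show "int (size {#x\<in>#proots f. x > c#}) - int (size {#x\<in>#proots g. x > c#}) \<le> 2 * k + 1"
      using k(2) unfolding left_diff_distrib[symmetric] cancel by linarith
    have "2 * k * pi \<le> (real (degree f) - real (degree g)) / 2 * pi"
      using k(3) by (simp add: field_simps)
    then have "real_of_int (4 * k) \<le> real_of_int (int (degree f) - int (degree g))"
      unfolding cancel by simp
    then show "4 * k \<le> int (degree f) - int (degree g)" by (simp only: of_int_le_iff)
    have "(real (degree f) - real (degree g)) / 2 * pi \<le> (2 * k + 1) * pi"
      using k(4) by (simp add: field_simps)
    then have "real_of_int (int (degree f) - int (degree g)) \<le> real_of_int (4 * k + 2)"
      unfolding cancel by simp
    then show "int (degree f) - int (degree g) \<le> 4 * k + 2" by (simp only: of_int_le_iff)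
  qed
qed

section \<open>From root counts to alternating root lists\<close>

lemma size_roots_greater: "size {#x\<in>#proots p. x > c#} = length (filter (\<lambda>x. x > c) (roots_desc p))"
proof -
  have "mset (roots_desc p) = proots p" by (simp add: roots_desc_def)
  then show ?thesis by (metis mset_filter size_mset)
qed

lemma length_filter_greater_ge:
  fixes xs :: "real list"
  assumes "sorted (rev xs)" "i < length xs" "xs ! i > c"
  shows "i < length (filter (\<lambda>x. x > c) xs)"
proof -
  have "{..i} \<subseteq> {j. j < length xs \<and> xs ! j > c}"
    using assms sorted_rev_nth_mono[OF assms(1)] by force
  then have "card {..i} \<le> card {j. j < length xs \<and> xs ! j > c}"
    by (rule card_mono[rotated]) simp
  then show ?thesis by (simp add: length_filter_conv_card)
qed

lemma length_filter_greater_le: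
  fixes xs :: "real list"
  assumes "sorted (rev xs)" "i < length xs" "xs ! i < c"
  shows "length (filter (\<lambda>x. x > c) xs) \<le> i"
proof -
  have "j < i" if "j < length xs" "xs ! j > c" for j
    using that assms sorted_rev_nth_mono[OF assms(1), of i j] by force
  then have "{j. j < length xs \<and> xs ! j > c} \<subseteq> {..<i}" by auto
  then have "card {j. j < length xs \<and> xs ! j > c} \<le> card {..<i}"
    by (rule card_mono[rotated]) simp
  then show ?thesis by (simp add: length_filter_conv_card)
qed

text \<open>Otherwise some threshold \<open>c\<close> outside \<open>E\<close> lies strictly between
  the two entries; then more than \<open>i + m\<close> entries of \<open>xs\<close> but at most
  \<open>i\<close> of \<open>ys\<close> exceed it. The shift \<open>m\<close> is 0 or 1 for the two
  kinds of inequality in the alternation.\<close>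

lemma nth_le_of_count_le:
  fixes xs ys :: "real list"
  assumes sorted: "sorted (rev xs)" "sorted (rev ys)" and fin: "finite E"
    and count: "\<And>c. c \<notin> E \<Longrightarrow>
      length (filter (\<lambda>x. x > c) xs) \<le> length (filter (\<lambda>x. x > c) ys) + m"
    and i: "i + m < length xs" "i < length ys"
  shows "xs ! (i + m) \<le> ys ! i"
proof (rule ccontr)
  assume "\<not> ?thesis"
  then have "infinite {ys ! i<..<xs ! (i + m)}" by simp
  then obtain c where c: "c \<in> {ys ! i<..<xs ! (i + m)}" "c \<notin> E"
    using fin by (meson finite_subset subsetI)
  then show False
    using count[OF c(2)] length_filter_greater_ge[OF sorted(1) i(1), of c]
      length_filter_greater_le[OF sorted(2) i(2), of c] by simp
qed

lemma interlaces_if_Im_ratio_nonneg: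
  fixes f g :: "real poly"
  assumes f: "real_rooted f" "lead_coeff f > 0" and g: "real_rooted g" "lead_coeff g > 0"
    and Im: "\<And>z. Im z > 0 \<Longrightarrow> Im (poly (map_poly of_real f) z / poly (map_poly of_real g) z) \<ge> 0"
  shows "g \<preceq> f"
proof -
  let ?u = "roots_desc g" and ?v = "roots_desc f"
  let ?E = "{x. poly f x = 0} \<union> {x. poly g x = 0}"
  have f0: "f \<noteq> 0" and g0: "g \<noteq> 0" using f g by auto
  have fin: "finite ?E" using f0 g0 by (simp add: poly_roots_finite)
  have len: "length ?u = degree g" "length ?v = degree f"
    using real_rooted_decompose(2)[OF f(1) f0] real_rooted_decompose(2)[OF g(1) g0]
    by (simp_all add: roots_desc_def flip: size_mset)
  have sorted: "sorted (rev ?u)" "sorted (rev ?v)" by (simp_all add: roots_desc_def)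
  have period: "\<exists>k::int. 2 * k \<le> int (length (filter (\<lambda>x. x > c) ?v)) - int (length (filter (\<lambda>x. x > c) ?u)) \<and>
      int (length (filter (\<lambda>x. x > c) ?v)) - int (length (filter (\<lambda>x. x > c) ?u)) \<le> 2 * k + 1 \<and>
      4 * k \<le> int (degree f) - int (degree g) \<and> int (degree f) - int (degree g) \<le> 4 * k + 2"
    if "c \<notin> ?E" for c
    using root_count_same_period[OF f g Im, of c] that unfolding size_roots_greater by auto
  have roots: "x \<in> ?E" if "x \<in> set ?u \<union> set ?v" for x
    using that f0 g0 by (auto simp: roots_desc_def)
  \<comment> \<open>All roots lie strictly between \<open>-B\<close> and \<open>B\<close>; the
    inserted 0 keeps the maximum defined when there are none.\<close>
  define B where "B = Max (insert 0 (abs ` ?E)) + 1"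
  have B: "\<bar>x\<bar> < B" if "x \<in> ?E" for x
  proof -
    have "\<bar>x\<bar> \<le> Max (insert 0 (abs ` ?E))" using that fin by (intro Max_ge) auto
    then show ?thesis by (simp add: B_def)
  qed
  have "B \<notin> ?E" "-B \<notin> ?E" using B[of B] B[of "-B"] by auto
  moreover have "filter (\<lambda>x. x > B) ?u = []" "filter (\<lambda>x. x > B) ?v = []"
    "filter (\<lambda>x. x > -B) ?u = ?u" "filter (\<lambda>x. x > -B) ?v = ?v"
    using roots B by (fastforce simp: filter_empty_conv filter_id_conv)+
  \<comment> \<open>At \<open>B\<close> both counts vanish, so \<open>k = 0\<close> and the degree
    difference is 0, 1 or 2. At \<open>-B\<close> the counts are the degrees; a difference of 2
    would need \<open>k = 1\<close>, contradicting \<open>4 * k \<le> 2\<close>.\<close>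
  ultimately have deg: "degree f = degree g \<or> degree f = degree g + 1"
    using period[of B] period[of "-B"] len by auto presburger
  have count: "length (filter (\<lambda>x. x > c) ?u) \<le> length (filter (\<lambda>x. x > c) ?v) + 0"
    "length (filter (\<lambda>x. x > c) ?v) \<le> length (filter (\<lambda>x. x > c) ?u) + 1" if cE: "c \<notin> ?E" for c
  proof -
    obtain k :: int where k:
      "2 * k \<le> int (length (filter (\<lambda>x. x > c) ?v)) - int (length (filter (\<lambda>x. x > c) ?u))"
      "int (length (filter (\<lambda>x. x > c) ?v)) - int (length (filter (\<lambda>x. x > c) ?u)) \<le> 2 * k + 1"
      "4 * k \<le> int (degree f) - int (degree g)" "int (degree f) - int (degree g) \<le> 4 * k + 2"
      using period[OF cE] by blast
    \<comment> \<open>The degrees fix \<open>k\<close> for every threshold, so the counts always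
      differ by 0 or 1.\<close>
    have "k = 0" using k(3,4) deg by linarith
    then show "length (filter (\<lambda>x. x > c) ?u) \<le> length (filter (\<lambda>x. x > c) ?v) + 0"
      "length (filter (\<lambda>x. x > c) ?v) \<le> length (filter (\<lambda>x. x > c) ?u) + 1"
      using k(1,2) by linarith+
  qed
  have uv: "?u ! i \<le> ?v ! i" if "i < degree g" for i
    using nth_le_of_count_le[OF sorted fin count(1), of i] that deg len by auto
  have vu: "?v ! (i + 1) \<le> ?u ! i" if "i < degree g" "i + 1 < degree f" for i
    using nth_le_of_count_le[OF sorted(2,1) fin count(2), of i] that len by auto
  show ?thesis
    unfolding interlaces_def Let_def using f g f0 g0 deg uv vu by auto
qed

section \<open>Restriction to rays\<close>

text \<open>Each permutation contributes a monomial whose coefficient is a product of numbers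
  \<open>l j\<close>, where \<open>j \<ge> 1\<close> because \<open>j\<close> is a value of the
  permutation.\<close>

lemma coeff_Khat_nonneg:
  fixes l :: "nat \<Rightarrow> real"
  assumes "\<And>j. j \<ge> 1 \<Longrightarrow> l j > 0"
  shows "coeff (Khat n (\<lambda>j. [:0, l j:])) k \<ge> 0"
proof -
  have "coeff (\<Prod>j\<in>PKV n \<pi>. [:0, l j:]) k \<ge> 0" if "\<pi> permutes {1..n}" for \<pi>
  proof -
    have "(\<Prod>j\<in>A. [:0, l j:]) = monom (\<Prod>j\<in>A. l j) (card A)" if "finite A" for A
      using that by (induction A) (auto simp: monom_Suc monom_0 smult_monom)
    moreover have "finite (PKV n \<pi>)" by (simp add: PKV_def)
    moreover have "\<forall>j\<in>PKV n \<pi>. j \<ge> 1"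
      using permutes_in_image[OF that] by (force simp: PKV_def peak_set_def)
    ultimately show ?thesis using assms by (auto intro!: prod_nonneg simp: less_imp_le)
  qed
  then show ?thesis unfolding Khat_def coeff_sum by (intro sum_nonneg) auto
qed

text \<open>Stability excludes zeros above the real axis, and conjugation those below. It also makes
  \<open>F\<close> nonzero, so the nonnegative leading coefficient is positive.\<close>

lemma Khat_univariate:
  fixes l :: "nat \<Rightarrow> real"
  assumes n: "n \<ge> 1" and l: "\<And>j. j \<ge> 1 \<Longrightarrow> l j > 0"
  defines "F \<equiv> Khat n (\<lambda>j. [:0, l j:])"
  shows "poly (map_poly of_real F) z = Khat n (\<lambda>j. z * complex_of_real (l j))"
    and "lead_coeff F > 0" and "real_rooted F"
proof -
  show eval: "poly (map_poly of_real F) z = Khat n (\<lambda>j. z * complex_of_real (l j))" for z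
    unfolding F_def of_real_poly_Khat by (simp add: map_poly_pCons)
  have nz: "poly (map_poly of_real F) z \<noteq> 0" if "Im z > 0" for z
    unfolding eval by (rule Khat_nonzero_upper[OF n]) (use that l in auto)
  have "F \<noteq> 0" using nz[of \<i>] by auto
  moreover have "lead_coeff F \<ge> 0" unfolding F_def by (rule coeff_Khat_nonneg[OF l])
  ultimately show "lead_coeff F > 0" by (simp add: order_less_le)
  show "real_rooted F"
    unfolding real_rooted_def
  proof (intro allI impI)
    fix z assume z: "poly (map_poly complex_of_real F) z = 0"
    have "poly (map_poly of_real F) (cnj z) = cnj (poly (map_poly of_real F) z)" for F
      by (induction F) (simp_all add: map_poly_pCons)
    then have "\<not> Im (cnj z) > 0" "\<not> Im z > 0" using nz[of z] nz[of "cnj z"] z by auto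
    then show "z \<in> \<real>" by (simp add: complex_is_Real_iff)
  qed
qed

theorem theorem6p3:
  shows "(\<forall>n\<ge>1. stable_poly n (Khat n)) \<and>
    (\<forall>(l::nat \<Rightarrow> real) n. (\<forall>j\<ge>1. l j > 0) \<longrightarrow> n > 1 \<longrightarrow>
       Khat (n - 1) (\<lambda>j. [:0, l j:]) \<preceq> Khat n (\<lambda>j. [:0, l j:]))"
proof (intro conjI allI impI)
  fix n :: nat assume "n \<ge> 1"
  then show "stable_poly n (Khat n)"
    unfolding stable_poly_def using Khat_nonzero_upper by blast
next
  fix l :: "nat \<Rightarrow> real" and n :: nat
  assume l: "\<forall>j\<ge>1. l j > 0" and "n > 1"
  then obtain m where n: "n = Suc m" and m: "m \<ge> 1" by (cases n) auto
  have eval: "poly (map_poly of_real (Khat k (\<lambda>j. [:0, l j:]))) z = Khat k (\<lambda>j. z * complex_of_real (l j))"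
    and pos: "lead_coeff (Khat k (\<lambda>j. [:0, l j:])) > 0"
    and real: "real_rooted (Khat k (\<lambda>j. [:0, l j:]))" if "k \<ge> 1" for k z
    using Khat_univariate[of k l] l that by auto
  show "Khat (n - 1) (\<lambda>j. [:0, l j:]) \<preceq> Khat n (\<lambda>j. [:0, l j:])"
    unfolding n diff_Suc_1
  proof (rule interlaces_if_Im_ratio_nonneg)
    fix z :: complex assume z: "Im z > 0"
    show "Im (poly (map_poly of_real (Khat (Suc m) (\<lambda>j. [:0, l j:]))) z /
        poly (map_poly of_real (Khat m (\<lambda>j. [:0, l j:]))) z) \<ge> 0"
      using Im_Khat_ratio_nonneg[of m l z] m l z by (simp add: eval)
  qed (use m in \<open>auto intro: pos real\<close>)
qed

end
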